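(* Let $n>2$ and let $X_1,\ldots,X_n$ be infinite dimensional Banach spaces. If $\alpha$ is a reasonable cross norm on $X_1\otimes\cdots\otimes X_n$ and $r\ge2$, then the metric space $(\mathcal{S}^r_{X_1,\ldots,X_n},d_\alpha)$ is not complete.
   Context: Banach spaces are over the same field $\mathbb{R}$ or $\mathbb{C}$; $X_1\otimes\cdots\otimes X_n$ is the algebraic tensor product. A norm $\alpha$ on $X_1\otimes\cdots\otimes X_n$ is a reasonable cross norm if (1) $\alpha(x_1\otimes\cdots\otimes x_n)\le\|x_1\|\cdots\|x_n\|$ for all $x_i\in X_i$, and (2) for all $x_i^*\in X_i^*$ the functional $x_1^*\otimes\cdots\otimes x_n^*$ is bounded for $\alpha$ with norm at most $\|x_1^*\|\cdots\|x_n^*\|$. The rank of $z\in X_1\otimes\cdots\otimes X_n$ is the least $r$ such that $z=\sum_{i=1}^r x_1^i\otimes\cdots\otimes x_n^i$ with $x_j^i\in X_j$; $\mathcal{S}^r_{X_1,\ldots,X_n}$ is the set of $z\in X_1\otimes\cdots\otimes X_n$ of rank $\le r$, and $d_\alpha(w,z)=\alpha(w-z)$. *)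

theory Defs
  imports "HOL-Analysis.Analysis" "HOL-Algebra.Module"
begin

section \<open>Scalars\<close>

text \<open>The scalar field is \<open>\<real>\<close> or \<open>\<complex>\<close> with its usual absolute value, up to an isometric isomorphism.\<close>

class real_or_complex_field = real_normed_field +
  assumes real_or_complex:
    "(\<forall>z. \<exists>a. z = a *\<^sub>R 1) \<or>
     (\<exists>j. j * j = - 1 \<and>
        (\<forall>z. \<exists>a b. z = a *\<^sub>R 1 + b *\<^sub>R j \<and> norm z = sqrt (a\<^sup>2 + b\<^sup>2)))"

instance real :: real_or_complex_field
  by standard simp

instance complex :: real_or_complex_field
proof
  have "\<exists>a b. z = a *\<^sub>R 1 + b *\<^sub>R \<i> \<and> norm z = sqrt (a\<^sup>2 + b\<^sup>2)" for z
    by (intro exI[of _ "Re z"] exI[of _ "Im z"]) (simp add: complex_eq_iff cmod_def)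
  then show "(\<forall>z::complex. \<exists>a. z = a *\<^sub>R 1) \<or>
     (\<exists>j::complex. j * j = - 1 \<and>
        (\<forall>z. \<exists>a b. z = a *\<^sub>R 1 + b *\<^sub>R j \<and> norm z = sqrt (a\<^sup>2 + b\<^sup>2)))"
    by (intro disjI2 exI[of _ \<i>]) simp
qed

text \<open>The field as a module over itself; it also serves as the ring of scalars.\<close>

definition scalars :: "('k::field, 'k) module" where
  "scalars = \<lparr>carrier = UNIV, mult = (*), one = 1, zero = 0, add = (+), smult = (*)\<rparr>"

lemma scalars_simps [simp]:
  "carrier scalars = UNIV" "x \<otimes>\<^bsub>scalars\<^esub> y = x * y" "\<one>\<^bsub>scalars\<^esub> = 1"
  "\<zero>\<^bsub>scalars\<^esub> = 0" "x \<oplus>\<^bsub>scalars\<^esub> y = x + y" "x \<odot>\<^bsub>scalars\<^esub> y = x * y"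
  by (simp_all add: scalars_def)

lemma module_scalars: "Module.module scalars (scalars :: ('k::field, 'k) module)"
proof -
  have ag: "abelian_group (scalars :: ('k, 'k) module)"
  proof (rule abelian_groupI)
    fix x :: 'k
    show "\<exists>y\<in>carrier scalars. y \<oplus>\<^bsub>scalars\<^esub> x = \<zero>\<^bsub>scalars\<^esub>"
      by (auto intro!: exI[of _ "- x"])
  qed (auto simp: algebra_simps)
  have "cring (scalars :: ('k, 'k) module)"
    by (rule cringI[OF ag]) (auto intro!: comm_monoidI simp: algebra_simps)
  from this ag show ?thesis
    by (rule moduleI) (auto simp: algebra_simps)
qed

lemma minus_scalars [simp]: "\<ominus>\<^bsub>scalars\<^esub> x = - (x :: 'k::field)"
proof -
  interpret S: Module.module scalars "scalars :: ('k, 'k) module" by (rule module_scalars)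
  show ?thesis by (rule S.R.minus_equality) auto
qed

section \<open>Normed and Banach spaces\<close>

text \<open>A vector space is a module (with explicit carrier) over \<^const>\<open>scalars\<close>; the fields
  \<open>mult\<close> and \<open>one\<close> of the module record are irrelevant.  Each space of a family has its own carrier, operations
  and norm; sharing the type of the elements loses nothing, since finitely many spaces over
  different types embed in the sum type.\<close>

locale normed_space = Module.module scalars V
  for V :: "('k::real_or_complex_field, 'a) module" (structure) and N :: "'a \<Rightarrow> real" +
  assumes norm_ge_0: "x \<in> carrier V \<Longrightarrow> 0 \<le> N x"
    and norm_eq_0_iff: "x \<in> carrier V \<Longrightarrow> N x = 0 \<longleftrightarrow> x = \<zero>"
    and norm_smult: "x \<in> carrier V \<Longrightarrow> N (a \<odot> x) = norm a * N x"
    and norm_add_le: "\<lbrakk>x \<in> carrier V; y \<in> carrier V\<rbrakk> \<Longrightarrow> N (x \<oplus> y) \<le> N x + N y"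

text \<open>The value outside the carrier is immaterial; it is set to \<open>0\<close> because \<^locale>\<open>Metric_space\<close>
  asks for symmetry and nonnegativity on the whole type.\<close>

definition norm_dist :: "('k, 'a) module \<Rightarrow> ('a \<Rightarrow> real) \<Rightarrow> 'a \<Rightarrow> 'a \<Rightarrow> real" where
  "norm_dist V N w z = (if w \<in> carrier V \<and> z \<in> carrier V then N (w \<ominus>\<^bsub>V\<^esub> z) else 0)"

lemma (in normed_space) Metric_space_norm_dist:
  assumes "S \<subseteq> carrier V"
  shows "Metric_space S (norm_dist V N)"
proof
  fix x y
  show "0 \<le> norm_dist V N x y"
    by (auto simp: norm_dist_def intro: norm_ge_0)
  show "norm_dist V N x y = norm_dist V N y x"
  proof (cases "x \<in> carrier V \<and> y \<in> carrier V")
    case True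
    then have "y \<ominus> x = (- 1) \<odot> (x \<ominus> y)"
      using smult_l_minus[of 1 "x \<ominus> y"] smult_one[of "x \<ominus> y"]
      by (simp add: a_minus_def M.minus_add M.a_comm)
    then show ?thesis
      using True norm_smult[of "x \<ominus> y" "- 1"] by (simp add: norm_dist_def)
  qed (auto simp: norm_dist_def)
next
  fix x y assume "x \<in> S" "y \<in> S"
  then show "norm_dist V N x y = 0 \<longleftrightarrow> x = y"
    using assms norm_eq_0_iff[of "x \<ominus> y"] M.r_neg M.minus_equality[of x "\<ominus> y"]
      by (auto simp: norm_dist_def subset_iff a_minus_def)
next
  fix x y z assume "x \<in> S" "y \<in> S" "z \<in> S"
  then have xyz: "x \<in> carrier V" "y \<in> carrier V" "z \<in> carrier V"
    using assms by auto
  then have "x \<ominus> z = (x \<ominus> y) \<oplus> (y \<ominus> z)"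
    by (simp add: a_minus_def M.a_assoc M.r_neg1)
  then show "norm_dist V N x z \<le> norm_dist V N x y + norm_dist V N y z"
    using xyz norm_add_le[of "x \<ominus> y" "y \<ominus> z"] by (simp add: norm_dist_def)
qed

locale banach_space = normed_space +
  assumes complete: "Metric_space.mcomplete (carrier V) (norm_dist V N)"

definition finite_dimensional :: "('k, 'a) module \<Rightarrow> bool" where
  "finite_dimensional V \<longleftrightarrow>
     (\<exists>B. finite B \<and> B \<subseteq> carrier V \<and>
        (\<forall>x\<in>carrier V. \<exists>c. x = (\<Oplus>\<^bsub>V\<^esub>b\<in>B. c b \<odot>\<^bsub>V\<^esub> b)))"

definition linear_map :: "('k, 'a) module \<Rightarrow> ('k, 'b) module \<Rightarrow> ('a \<Rightarrow> 'b) \<Rightarrow> bool" where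
  "linear_map V W h \<longleftrightarrow>
     h \<in> carrier V \<rightarrow> carrier W \<and>
     (\<forall>x\<in>carrier V. \<forall>y\<in>carrier V. h (x \<oplus>\<^bsub>V\<^esub> y) = h x \<oplus>\<^bsub>W\<^esub> h y) \<and>
     (\<forall>a. \<forall>x\<in>carrier V. h (a \<odot>\<^bsub>V\<^esub> x) = a \<odot>\<^bsub>W\<^esub> h x)"

definition bounded_functional ::
    "('k::real_normed_field, 'a) module \<Rightarrow> ('a \<Rightarrow> real) \<Rightarrow> ('a \<Rightarrow> 'k) \<Rightarrow> bool" where
  "bounded_functional V N \<phi> \<longleftrightarrow>
     linear_map V scalars \<phi> \<and> (\<exists>C. \<forall>x\<in>carrier V. norm (\<phi> x) \<le> C * N x)"

definition dual_norm ::
    "('k::real_normed_field, 'a) module \<Rightarrow> ('a \<Rightarrow> real) \<Rightarrow> ('a \<Rightarrow> 'k) \<Rightarrow> real" where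
  "dual_norm V N \<phi> = (SUP x\<in>{x \<in> carrier V. N x \<le> 1}. norm (\<phi> x))"

section \<open>The algebraic tensor product\<close>

abbreviation tuples :: "'i set \<Rightarrow> ('i \<Rightarrow> ('k, 'a) module) \<Rightarrow> ('i \<Rightarrow> 'a) set" where
  "tuples I X \<equiv> (\<Pi>\<^sub>E i\<in>I. carrier (X i))"

definition multilinear_map ::
    "'i set \<Rightarrow> ('i \<Rightarrow> ('k, 'a) module) \<Rightarrow> ('k, 'b) module \<Rightarrow> (('i \<Rightarrow> 'a) \<Rightarrow> 'b) \<Rightarrow> bool" where
  "multilinear_map I X W f \<longleftrightarrow>
     f \<in> tuples I X \<rightarrow> carrier W \<and>
     (\<forall>x\<in>tuples I X. \<forall>i\<in>I. linear_map (X i) W (\<lambda>y. f (x(i := y))))"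

text \<open>As is usual for Banach spaces (cf. Ryan, Introduction to Tensor Products of Banach Spaces),
  the algebraic tensor product is realised inside the algebraic dual of the space of multilinear
  forms: \<open>x\<^sub>1 \<otimes> \<dots> \<otimes> x\<^sub>n\<close> is evaluation at \<open>(x\<^sub>1, \<dots>, x\<^sub>n)\<close>, and the tensor product is the linear span
  of these evaluations.  The elements are made canonical by the value \<open>0\<close> at arguments that are not
  multilinear forms.  By \<open>multilinear_pure_tensor\<close> and \<open>tensor_space_universal\<close> below, this is
  the algebraic tensor product with its universal property.\<close>

definition pure_tensor ::
    "'i set \<Rightarrow> ('i \<Rightarrow> ('k::field, 'a) module) \<Rightarrow> ('i \<Rightarrow> 'a) \<Rightarrow> (('i \<Rightarrow> 'a) \<Rightarrow> 'k) \<Rightarrow> 'k" where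
  "pure_tensor I X x = (\<lambda>A. if multilinear_map I X scalars A then A x else 0)"

definition tensor_space ::
    "'i set \<Rightarrow> ('i \<Rightarrow> ('k::field, 'a) module) \<Rightarrow> ('k, (('i \<Rightarrow> 'a) \<Rightarrow> 'k) \<Rightarrow> 'k) module" where
  "tensor_space I X =
     \<lparr>carrier = {z. \<exists>m c x. (\<forall>j<m. x j \<in> tuples I X) \<and>
                   z = (\<lambda>A. \<Sum>j<(m::nat). c j * pure_tensor I X (x j) A)},
      mult = undefined, one = undefined,
      zero = (\<lambda>A. 0), add = (\<lambda>w z A. w A + z A), smult = (\<lambda>a z A. a * z A)\<rparr>"

definition tensor_rank ::
    "'i set \<Rightarrow> ('i \<Rightarrow> ('k::field, 'a) module) \<Rightarrow> ((('i \<Rightarrow> 'a) \<Rightarrow> 'k) \<Rightarrow> 'k) \<Rightarrow> nat" where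
  "tensor_rank I X z =
     (LEAST r. \<exists>x. (\<forall>j<r. x j \<in> tuples I X) \<and> z = (\<lambda>A. \<Sum>j<r. pure_tensor I X (x j) A))"

definition rank_le ::
    "nat \<Rightarrow> 'i set \<Rightarrow> ('i \<Rightarrow> ('k::field, 'a) module) \<Rightarrow> ((('i \<Rightarrow> 'a) \<Rightarrow> 'k) \<Rightarrow> 'k) set" where
  "rank_le r I X = {z \<in> carrier (tensor_space I X). tensor_rank I X z \<le> r}"

text \<open>\<open>\<phi>\<^sub>1 \<otimes> \<dots> \<otimes> \<phi>\<^sub>n\<close> is evaluation at the multilinear form \<open>x \<mapsto> \<phi>\<^sub>1(x\<^sub>1) \<cdots> \<phi>\<^sub>n(x\<^sub>n)\<close>; see
  \<open>tensor_functional_pure\<close>.\<close>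

definition tensor_functional ::
    "'i set \<Rightarrow> ('i \<Rightarrow> 'a \<Rightarrow> 'k) \<Rightarrow> ((('i \<Rightarrow> 'a) \<Rightarrow> 'k) \<Rightarrow> 'k) \<Rightarrow> 'k::field" where
  "tensor_functional I \<phi> z = z (\<lambda>x. \<Prod>i\<in>I. \<phi> i (x i))"

definition reasonable_cross_norm ::
    "'i set \<Rightarrow> ('i \<Rightarrow> ('k::real_or_complex_field, 'a) module) \<Rightarrow> ('i \<Rightarrow> 'a \<Rightarrow> real) \<Rightarrow>
     (((('i \<Rightarrow> 'a) \<Rightarrow> 'k) \<Rightarrow> 'k) \<Rightarrow> real) \<Rightarrow> bool" where
  "reasonable_cross_norm I X N \<alpha> \<longleftrightarrow>
     normed_space (tensor_space I X) \<alpha> \<and>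
     (\<forall>x\<in>tuples I X. \<alpha> (pure_tensor I X x) \<le> (\<Prod>i\<in>I. N i (x i))) \<and>
     (\<forall>\<phi>. (\<forall>i\<in>I. bounded_functional (X i) (N i) (\<phi> i)) \<longrightarrow>
        bounded_functional (tensor_space I X) \<alpha> (tensor_functional I \<phi>) \<and>
        dual_norm (tensor_space I X) \<alpha> (tensor_functional I \<phi>)
          \<le> (\<Prod>i\<in>I. dual_norm (X i) (N i) (\<phi> i)))"

section \<open>The universal property\<close>

lemma linear_mapD:
  assumes "linear_map V W h"
  shows "x \<in> carrier V \<Longrightarrow> h x \<in> carrier W"
    and "\<lbrakk>x \<in> carrier V; y \<in> carrier V\<rbrakk> \<Longrightarrow> h (x \<oplus>\<^bsub>V\<^esub> y) = h x \<oplus>\<^bsub>W\<^esub> h y"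
    and "x \<in> carrier V \<Longrightarrow> h (a \<odot>\<^bsub>V\<^esub> x) = a \<odot>\<^bsub>W\<^esub> h x"
  using assms by (auto simp: linear_map_def)

lemma tensor_space_simps [simp]:
  "\<zero>\<^bsub>tensor_space I X\<^esub> = (\<lambda>A. 0)"
  "w \<oplus>\<^bsub>tensor_space I X\<^esub> z = (\<lambda>A. w A + z A)"
  "a \<odot>\<^bsub>tensor_space I X\<^esub> z = (\<lambda>A. a * z A)"
  by (simp_all add: tensor_space_def)

lemma tensor_space_induct [consumes 1, case_names zero add]:
  assumes "z \<in> carrier (tensor_space I X)"
    and "P (\<lambda>A. 0)"
    and "\<And>z c x. \<lbrakk>z \<in> carrier (tensor_space I X); x \<in> tuples I X; P z\<rbrakk>
           \<Longrightarrow> P (\<lambda>A. z A + c * pure_tensor I X x A)"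
  shows "P z"
proof -
  obtain m c x where x: "\<forall>j<(m::nat). x j \<in> tuples I X"
    and z: "z = (\<lambda>A. \<Sum>j<m. c j * pure_tensor I X (x j) A)"
    using assms(1) by (auto simp: tensor_space_def)
  have "P (\<lambda>A. \<Sum>j<k. c j * pure_tensor I X (x j) A)" if "k \<le> m" for k
    using that
  proof (induction k)
    case (Suc k)
    have "(\<lambda>A. \<Sum>j<k. c j * pure_tensor I X (x j) A) \<in> carrier (tensor_space I X)"
      using x Suc.prems unfolding tensor_space_def
      by (simp, intro exI[of _ k] exI[of _ c] exI[of _ x]) simp
    from assms(3)[OF this, of "x k" "c k"] Suc x show ?case by simp
  qed (use assms(2) in simp)
  then show ?thesis using z by simp
qed

lemma zero_in_tensor_space: "(\<lambda>A. 0) \<in> carrier (tensor_space I X)"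
  unfolding tensor_space_def by (auto intro!: exI[of _ 0])

lemma tensor_space_add_smult_pure:
  assumes "z \<in> carrier (tensor_space I X)" "x \<in> tuples I X"
  shows "(\<lambda>A. z A + c * pure_tensor I X x A) \<in> carrier (tensor_space I X)"
proof -
  obtain m d y where y: "\<forall>j<(m::nat). y j \<in> tuples I X"
    and z: "z = (\<lambda>A. \<Sum>j<m. d j * pure_tensor I X (y j) A)"
    using assms(1) by (auto simp: tensor_space_def)
  show ?thesis
    unfolding tensor_space_def z using y assms(2)
    by (simp, intro exI[of _ "Suc m"] exI[of _ "d(m := c)"] exI[of _ "y(m := x)"]) simp
qed

lemma pure_in_tensor_space:
  "x \<in> tuples I X \<Longrightarrow> pure_tensor I X x \<in> carrier (tensor_space I X)"
  using tensor_space_add_smult_pure[OF zero_in_tensor_space, of x I X 1] by simp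

lemma tensor_space_add:
  assumes "z \<in> carrier (tensor_space I X)" "w \<in> carrier (tensor_space I X)"
  shows "(\<lambda>A. w A + z A) \<in> carrier (tensor_space I X)"
  using assms(1)
proof (induction rule: tensor_space_induct)
  case (add z c x)
  from tensor_space_add_smult_pure[OF add(3,2), of c] show ?case by (simp add: add.assoc)
qed (use assms(2) in simp)

lemma tensor_space_smult:
  assumes "z \<in> carrier (tensor_space I X)"
  shows "(\<lambda>A. a * z A) \<in> carrier (tensor_space I X)"
  using assms
proof (induction rule: tensor_space_induct)
  case (add z c x)
  from tensor_space_add_smult_pure[OF add(3,2), of "a * c"] show ?case
    by (simp add: algebra_simps)
qed (simp add: zero_in_tensor_space)

lemma module_tensor_space:
  fixes X :: "'i \<Rightarrow> ('k::field, 'a) module"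
  shows "Module.module scalars (tensor_space I X)"
proof -
  interpret S: Module.module scalars "scalars :: ('k, 'k) module" by (rule module_scalars)
  have ag: "abelian_group (tensor_space I X)"
  proof (rule abelian_groupI)
    fix z assume "z \<in> carrier (tensor_space I X)"
    from tensor_space_smult[OF this, of "- 1"]
    show "\<exists>y\<in>carrier (tensor_space I X). y \<oplus>\<^bsub>tensor_space I X\<^esub> z = \<zero>\<^bsub>tensor_space I X\<^esub>"
      by (intro bexI) auto
  qed (auto simp: algebra_simps zero_in_tensor_space intro: tensor_space_add)
  show ?thesis
    by (rule moduleI[OF S.R.is_cring ag]) (auto simp: algebra_simps intro: tensor_space_smult)
qed

lemma tuples_upd: "\<lbrakk>x \<in> tuples I X; i \<in> I; y \<in> carrier (X i)\<rbrakk> \<Longrightarrow> x(i := y) \<in> tuples I X"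
  by (auto simp: PiE_iff extensional_def)

lemma multilinear_pure_tensor:
  assumes "\<And>i. i \<in> I \<Longrightarrow> Module.module scalars (X i)"
  shows "multilinear_map I X (tensor_space I X) (pure_tensor I X)"
  unfolding multilinear_map_def
proof (intro conjI ballI)
  fix x i assume x: "x \<in> tuples I X" and i: "i \<in> I"
  show "linear_map (X i) (tensor_space I X) (\<lambda>y. pure_tensor I X (x(i := y)))"
    unfolding linear_map_def
  proof (intro conjI ballI allI)
    show "(\<lambda>y. pure_tensor I X (x(i := y))) \<in> carrier (X i) \<rightarrow> carrier (tensor_space I X)"
      using x i by (auto intro!: pure_in_tensor_space tuples_upd)
  qed (use x i in \<open>auto simp: pure_tensor_def multilinear_map_def linear_map_def fun_eq_iff\<close>)
qed (auto intro: pure_in_tensor_space)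

lemma rank_le_iff:
  assumes "\<And>i. i \<in> I \<Longrightarrow> Module.module scalars (X i)" and "I \<noteq> {}"
  shows "z \<in> rank_le r I X \<longleftrightarrow>
    (\<exists>s\<le>r. \<exists>x. (\<forall>j<s. x j \<in> tuples I X) \<and> z = (\<lambda>A. \<Sum>j<s. pure_tensor I X (x j) A))"
    (is "_ \<longleftrightarrow> (\<exists>s\<le>r. ?rep z s)")
proof
  obtain i where i: "i \<in> I" using assms(2) by blast
  interpret Module.module scalars "X i" using assms(1)[OF i] .
  assume z: "z \<in> rank_le r I X"
  then obtain m c x where x: "\<forall>j<(m::nat). x j \<in> tuples I X"
    and zeq: "z = (\<lambda>A. \<Sum>j<m. c j * pure_tensor I X (x j) A)"
    by (auto simp: rank_le_def tensor_space_def)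
  define y where "y j = (x j)(i := c j \<odot>\<^bsub>X i\<^esub> x j i)" for j
  have xi: "x j i \<in> carrier (X i)" if "j < m" for j
    using x i that by (blast dest: PiE_mem)
  have "y j \<in> tuples I X" if "j < m" for j
    unfolding y_def using x i that xi[OF that] by (intro tuples_upd) auto
  moreover have "c j * pure_tensor I X (x j) A = pure_tensor I X (y j) A" if "j < m" for j A
  proof -
    have "linear_map (X i) (tensor_space I X) (\<lambda>v. pure_tensor I X ((x j)(i := v)))"
      using multilinear_pure_tensor[of I X, OF assms(1)] x i that
      unfolding multilinear_map_def by blast
    from linear_mapD(3)[OF this xi[OF that], of "c j"] show ?thesis
      by (simp add: y_def)
  qed
  ultimately have "?rep z m"
    unfolding zeq by (intro exI[of _ y]) (auto intro!: sum.cong)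
  then have "?rep z (tensor_rank I X z)"
    unfolding tensor_rank_def by (rule LeastI)
  then show "\<exists>s\<le>r. ?rep z s"
    using z unfolding rank_le_def by blast
next
  assume "\<exists>s\<le>r. ?rep z s"
  then obtain s x where s: "s \<le> r" and x: "\<forall>j<s. x j \<in> tuples I X"
    and z: "z = (\<lambda>A. \<Sum>j<s. pure_tensor I X (x j) A)" by blast
  have "z \<in> carrier (tensor_space I X)"
    unfolding tensor_space_def z using x
    by (simp, intro exI[of _ s] exI[of _ "\<lambda>_. 1"] exI[of _ x]) simp
  moreover have "tensor_rank I X z \<le> s"
    unfolding tensor_rank_def by (rule Least_le) (use x z in blast)
  ultimately show "z \<in> rank_le r I X"
    using s by (simp add: rank_le_def)
qed

lemma multilinear_prod:
  fixes \<phi> :: "'i \<Rightarrow> 'a \<Rightarrow> 'k::field"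
  assumes "finite I" "\<And>i. i \<in> I \<Longrightarrow> linear_map (X i) scalars (\<phi> i)"
  shows "multilinear_map I X scalars (\<lambda>x. \<Prod>i\<in>I. \<phi> i (x i))"
proof -
  have *: "(\<Prod>l\<in>I. \<phi> l ((x(i := y)) l)) = \<phi> i y * (\<Prod>l\<in>I - {i}. \<phi> l (x l))"
    if "i \<in> I" for x i y
    using that assms(1) by (auto simp: prod.remove intro!: arg_cong2[of _ _ _ _ "(*)"] prod.cong)
  show ?thesis
    using assms(2) by (auto simp: multilinear_map_def linear_map_def * algebra_simps simp del: fun_upd_apply)
qed

lemma tensor_functional_pure:
  assumes "finite I" "\<And>i. i \<in> I \<Longrightarrow> linear_map (X i) scalars (\<phi> i)"
  shows "tensor_functional I \<phi> (pure_tensor I X x) = (\<Prod>i\<in>I. \<phi> i (x i))"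
  using multilinear_prod[OF assms] by (simp add: tensor_functional_def pure_tensor_def)

lemma linear_map_tensor_functional:
  "linear_map (tensor_space I X) scalars (tensor_functional I \<phi>)"
  by (auto simp: linear_map_def tensor_functional_def)

lemma linear_functional_separates:
  fixes W :: "('k::field, 'a) module"
  assumes "Module.module scalars W" and w: "w \<in> carrier W" "w \<noteq> \<zero>\<^bsub>W\<^esub>"
  shows "\<exists>\<phi>. linear_map W scalars \<phi> \<and> \<phi> w \<noteq> 0"
proof -
  interpret Module.module scalars W by fact
  have distr: "(a + b) \<odot>\<^bsub>W\<^esub> x = a \<odot>\<^bsub>W\<^esub> x \<oplus>\<^bsub>W\<^esub> b \<odot>\<^bsub>W\<^esub> x" if "x \<in> carrier W" for a b x
    using smult_l_distr[of a b x] that by simp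
  have assoc: "(a * b) \<odot>\<^bsub>W\<^esub> x = a \<odot>\<^bsub>W\<^esub> (b \<odot>\<^bsub>W\<^esub> x)" if "x \<in> carrier W" for a b x
    using smult_assoc1[of a b x] that by simp
  have one: "1 \<odot>\<^bsub>W\<^esub> x = x" and null: "0 \<odot>\<^bsub>W\<^esub> x = \<zero>\<^bsub>W\<^esub>" if "x \<in> carrier W" for x
    using smult_one[of x] smult_l_null[of x] that by simp_all
  have cl [simp]: "a \<odot>\<^bsub>W\<^esub> x \<in> carrier W" if "x \<in> carrier W" for a x
    using smult_closed[of a x] that by simp
  have distr2: "a \<odot>\<^bsub>W\<^esub> (x \<oplus>\<^bsub>W\<^esub> y) = a \<odot>\<^bsub>W\<^esub> x \<oplus>\<^bsub>W\<^esub> a \<odot>\<^bsub>W\<^esub> y"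
    if "x \<in> carrier W" "y \<in> carrier W" for a x y
    using smult_r_distr[of a x y] that by simp
  define sub where "sub H \<longleftrightarrow> H \<subseteq> carrier W \<and> \<zero>\<^bsub>W\<^esub> \<in> H \<and> (\<forall>x\<in>H. \<forall>y\<in>H. x \<oplus>\<^bsub>W\<^esub> y \<in> H) \<and>
    (\<forall>a. \<forall>x\<in>H. a \<odot>\<^bsub>W\<^esub> x \<in> H)" for H
  define \<A> where "\<A> = {H. sub H \<and> w \<notin> H}"
  have "\<exists>H\<in>\<A>. \<forall>K\<in>\<A>. H \<subseteq> K \<longrightarrow> K = H"
  proof (rule subset_Zorn_nonempty)
    have "{\<zero>\<^bsub>W\<^esub>} \<in> \<A>"
      using w smult_r_null by (auto simp: \<A>_def sub_def)
    then show "\<A> \<noteq> {}" by blast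
  next
    fix \<C> assume ne: "\<C> \<noteq> {}" and ch: "subset.chain \<A> \<C>"
    have sub: "sub H" and nw: "w \<notin> H" if "H \<in> \<C>" for H
      using ch that by (auto simp: subset.chain_def \<A>_def)
    have "x \<oplus>\<^bsub>W\<^esub> y \<in> \<Union>\<C>" if "x \<in> H" "H \<in> \<C>" "y \<in> K" "K \<in> \<C>" for x y H K
    proof -
      have "H \<subseteq> K \<or> K \<subseteq> H"
        using ch that unfolding subset.chain_def by blast
      then show ?thesis
        using that sub[of H] sub[of K] unfolding sub_def by blast
    qed
    moreover have "\<Union>\<C> \<subseteq> carrier W" "\<zero>\<^bsub>W\<^esub> \<in> \<Union>\<C>"
      using sub ne by (fastforce simp: sub_def)+
    moreover have "a \<odot>\<^bsub>W\<^esub> x \<in> \<Union>\<C>" if "x \<in> \<Union>\<C>" for a x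
      using sub that by (fastforce simp: sub_def)
    ultimately have "sub (\<Union>\<C>)"
      unfolding sub_def by blast
    then show "\<Union>\<C> \<in> \<A>"
      using nw by (auto simp: \<A>_def)
  qed
  then obtain H where H: "sub H" "w \<notin> H" and max: "\<And>K. \<lbrakk>sub K; w \<notin> K; H \<subseteq> K\<rbrakk> \<Longrightarrow> K = H"
    unfolding \<A>_def by blast
  have Hc: "x \<in> carrier W" if "x \<in> H" for x using H that by (auto simp: sub_def)
  have H0: "\<zero>\<^bsub>W\<^esub> \<in> H" and Hadd: "\<And>x y. \<lbrakk>x \<in> H; y \<in> H\<rbrakk> \<Longrightarrow> x \<oplus>\<^bsub>W\<^esub> y \<in> H"
    and Hsm: "\<And>a x. x \<in> H \<Longrightarrow> a \<odot>\<^bsub>W\<^esub> x \<in> H"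
    using H by (auto simp: sub_def)
  have ex: "\<exists>c. v \<oplus>\<^bsub>W\<^esub> (- c) \<odot>\<^bsub>W\<^esub> w \<in> H" if v: "v \<in> carrier W" for v
  proof (cases "v \<in> H")
    case True
    then show ?thesis using v w by (intro exI[of _ 0]) (simp add: null)
  next
    case False
    define K where "K = {h \<oplus>\<^bsub>W\<^esub> a \<odot>\<^bsub>W\<^esub> v | h a. h \<in> H}"
    have "x \<oplus>\<^bsub>W\<^esub> y \<in> K" if xy: "x \<in> K" "y \<in> K" for x y
    proof -
      obtain h a k b where "x = h \<oplus>\<^bsub>W\<^esub> a \<odot>\<^bsub>W\<^esub> v" "y = k \<oplus>\<^bsub>W\<^esub> b \<odot>\<^bsub>W\<^esub> v" and hk: "h \<in> H" "k \<in> H"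
        using xy unfolding K_def by blast
      then have "x \<oplus>\<^bsub>W\<^esub> y = (h \<oplus>\<^bsub>W\<^esub> k) \<oplus>\<^bsub>W\<^esub> (a + b) \<odot>\<^bsub>W\<^esub> v"
        using v Hc by (simp add: distr M.add.m_ac)
      then show ?thesis using Hadd[OF hk] unfolding K_def by blast
    qed
    moreover have "c \<odot>\<^bsub>W\<^esub> x \<in> K" if x: "x \<in> K" for c x
    proof -
      obtain h a where "x = h \<oplus>\<^bsub>W\<^esub> a \<odot>\<^bsub>W\<^esub> v" and h: "h \<in> H"
        using x unfolding K_def by blast
      then have "c \<odot>\<^bsub>W\<^esub> x = c \<odot>\<^bsub>W\<^esub> h \<oplus>\<^bsub>W\<^esub> (c * a) \<odot>\<^bsub>W\<^esub> v"
        using v Hc by (simp add: distr2 assoc)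
      then show ?thesis using Hsm[OF h] unfolding K_def by blast
    qed
    moreover have HK: "H \<subseteq> K"
    proof
      fix h assume "h \<in> H"
      moreover from this have "h = h \<oplus>\<^bsub>W\<^esub> 0 \<odot>\<^bsub>W\<^esub> v" using v Hc by (simp add: null)
      ultimately show "h \<in> K" unfolding K_def by blast
    qed
    moreover have "K \<subseteq> carrier W"
      using v Hc by (auto simp: K_def)
    ultimately have "sub K"
      using H0 unfolding sub_def by blast
    moreover have "v \<in> K"
      unfolding K_def using H0 v by (auto intro!: exI[of _ "\<zero>\<^bsub>W\<^esub>"] exI[of _ 1] simp: one)
    ultimately have "w \<in> K"
      using max[of K] HK False by blast
    then obtain h a where wh: "w = h \<oplus>\<^bsub>W\<^esub> a \<odot>\<^bsub>W\<^esub> v" and h: "h \<in> H"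
      unfolding K_def by blast
    have "a \<noteq> 0" using wh h v Hc H by (auto simp: null)
    have "v \<oplus>\<^bsub>W\<^esub> (- (1 / a)) \<odot>\<^bsub>W\<^esub> w = v \<oplus>\<^bsub>W\<^esub> ((- (1 / a)) \<odot>\<^bsub>W\<^esub> h \<oplus>\<^bsub>W\<^esub> (- 1) \<odot>\<^bsub>W\<^esub> v)"
      using \<open>a \<noteq> 0\<close> h v Hc by (simp add: wh distr2 flip: assoc)
    also have "\<dots> = (- (1 / a)) \<odot>\<^bsub>W\<^esub> h \<oplus>\<^bsub>W\<^esub> (1 \<odot>\<^bsub>W\<^esub> v \<oplus>\<^bsub>W\<^esub> (- 1) \<odot>\<^bsub>W\<^esub> v)"
      using h v Hc by (simp add: one M.add.m_ac)
    also have "\<dots> = (- (1 / a)) \<odot>\<^bsub>W\<^esub> h"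
      using h v Hc by (simp add: null flip: distr)
    finally show ?thesis using Hsm[OF h] by metis
  qed
  have uniq: "c = d" if cd: "v \<oplus>\<^bsub>W\<^esub> (- c) \<odot>\<^bsub>W\<^esub> w \<in> H" "v \<oplus>\<^bsub>W\<^esub> (- d) \<odot>\<^bsub>W\<^esub> w \<in> H"
    and v: "v \<in> carrier W" for v c d
  proof (rule ccontr)
    assume "c \<noteq> d"
    have "(v \<oplus>\<^bsub>W\<^esub> (- c) \<odot>\<^bsub>W\<^esub> w) \<oplus>\<^bsub>W\<^esub> (- 1) \<odot>\<^bsub>W\<^esub> (v \<oplus>\<^bsub>W\<^esub> (- d) \<odot>\<^bsub>W\<^esub> w)
        = (1 \<odot>\<^bsub>W\<^esub> v \<oplus>\<^bsub>W\<^esub> (- 1) \<odot>\<^bsub>W\<^esub> v) \<oplus>\<^bsub>W\<^esub> ((- c) \<odot>\<^bsub>W\<^esub> w \<oplus>\<^bsub>W\<^esub> d \<odot>\<^bsub>W\<^esub> w)"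
      using v w by (simp add: distr2 one M.add.m_ac flip: assoc)
    also have "\<dots> = (d - c) \<odot>\<^bsub>W\<^esub> w"
      using v w by (simp add: null flip: distr)
    finally have "(d - c) \<odot>\<^bsub>W\<^esub> w \<in> H"
      using Hadd[OF cd(1) Hsm[OF cd(2), of "- 1"]] by simp
    from Hsm[OF this, of "1 / (d - c)"] have "w \<in> H"
      using \<open>c \<noteq> d\<close> w by (simp add: one flip: assoc)
    then show False using H by blast
  qed
  define \<phi> where "\<phi> v = (THE c. v \<oplus>\<^bsub>W\<^esub> (- c) \<odot>\<^bsub>W\<^esub> w \<in> H)" for v
  have \<phi>I: "\<phi> v = c" if "v \<oplus>\<^bsub>W\<^esub> (- c) \<odot>\<^bsub>W\<^esub> w \<in> H" "v \<in> carrier W" for v c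
    unfolding \<phi>_def using that uniq by (intro the_equality) blast+
  have \<phi>: "v \<oplus>\<^bsub>W\<^esub> (- \<phi> v) \<odot>\<^bsub>W\<^esub> w \<in> H" if "v \<in> carrier W" for v
    using ex[OF that] \<phi>I that by metis
  have "linear_map W scalars \<phi>"
    unfolding linear_map_def
  proof (intro conjI ballI allI)
    fix x y assume xy: "x \<in> carrier W" "y \<in> carrier W"
    have "(x \<oplus>\<^bsub>W\<^esub> (- \<phi> x) \<odot>\<^bsub>W\<^esub> w) \<oplus>\<^bsub>W\<^esub> (y \<oplus>\<^bsub>W\<^esub> (- \<phi> y) \<odot>\<^bsub>W\<^esub> w)
        = (x \<oplus>\<^bsub>W\<^esub> y) \<oplus>\<^bsub>W\<^esub> ((- \<phi> x) \<odot>\<^bsub>W\<^esub> w \<oplus>\<^bsub>W\<^esub> (- \<phi> y) \<odot>\<^bsub>W\<^esub> w)"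
      using xy w by (simp add: M.add.m_ac)
    also have "\<dots> = (x \<oplus>\<^bsub>W\<^esub> y) \<oplus>\<^bsub>W\<^esub> (- (\<phi> x + \<phi> y)) \<odot>\<^bsub>W\<^esub> w"
      using w by (simp add: add.commute flip: distr)
    finally show "\<phi> (x \<oplus>\<^bsub>W\<^esub> y) = \<phi> x \<oplus>\<^bsub>scalars\<^esub> \<phi> y"
      using Hadd[OF \<phi>[OF xy(1)] \<phi>[OF xy(2)]] xy by (auto intro: \<phi>I)
  next
    fix a x assume x: "x \<in> carrier W"
    have "a \<odot>\<^bsub>W\<^esub> (x \<oplus>\<^bsub>W\<^esub> (- \<phi> x) \<odot>\<^bsub>W\<^esub> w) = a \<odot>\<^bsub>W\<^esub> x \<oplus>\<^bsub>W\<^esub> (- (a * \<phi> x)) \<odot>\<^bsub>W\<^esub> w"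
      using x w by (simp add: distr2 flip: assoc)
    then show "\<phi> (a \<odot>\<^bsub>W\<^esub> x) = a \<odot>\<^bsub>scalars\<^esub> \<phi> x"
      using Hsm[OF \<phi>[OF x], of a] x by (auto intro: \<phi>I)
  qed simp
  moreover have "w \<oplus>\<^bsub>W\<^esub> (- 1) \<odot>\<^bsub>W\<^esub> w = (1 + - 1) \<odot>\<^bsub>W\<^esub> w"
    by (simp only: distr[OF w(1)] one[OF w(1)])
  then have "w \<oplus>\<^bsub>W\<^esub> (- 1) \<odot>\<^bsub>W\<^esub> w = \<zero>\<^bsub>W\<^esub>"
    using null[OF w(1)] by simp
  then have "\<phi> w = 1" using H0 w by (intro \<phi>I) simp_all
  ultimately show ?thesis by (intro exI[of _ \<phi>]) simp
qed

theorem tensor_space_universal: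
  fixes X :: "'i \<Rightarrow> ('k::field, 'a) module" and W :: "('k, 'b) module"
  assumes W: "Module.module scalars W" and f: "multilinear_map I X W f"
  shows "\<exists>h. linear_map (tensor_space I X) W h \<and> (\<forall>x\<in>tuples I X. h (pure_tensor I X x) = f x) \<and>
    (\<forall>h'. linear_map (tensor_space I X) W h' \<and> (\<forall>x\<in>tuples I X. h' (pure_tensor I X x) = f x) \<longrightarrow>
       (\<forall>z\<in>carrier (tensor_space I X). h' z = h z))"
proof -
  interpret Module.module scalars W by fact
  let ?T = "tensor_space I X"
  have cl [simp]: "a \<odot>\<^bsub>W\<^esub> x \<in> carrier W" if "x \<in> carrier W" for a x
    using smult_closed[of a x] that by simp
  have fc: "f x \<in> carrier W" if "x \<in> tuples I X" for x
    using f that by (auto simp: multilinear_map_def)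
  have \<phi>f: "multilinear_map I X scalars (\<lambda>x. \<phi> (f x))" if \<phi>: "linear_map W scalars \<phi>" for \<phi>
    unfolding multilinear_map_def
  proof (intro conjI ballI)
    fix x i assume "x \<in> tuples I X" "i \<in> I"
    then have lin: "linear_map (X i) W (\<lambda>y. f (x(i := y)))"
      using f by (auto simp: multilinear_map_def)
    show "linear_map (X i) scalars (\<lambda>y. \<phi> (f (x(i := y))))"
      using linear_mapD[OF lin] linear_mapD[OF \<phi>] by (auto simp: linear_map_def)
  qed auto
  define P where "P z w \<longleftrightarrow> w \<in> carrier W \<and>
    (\<forall>\<phi>. linear_map W scalars \<phi> \<longrightarrow> \<phi> w = z (\<lambda>x. \<phi> (f x)))" for z w
  have Padd: "P (\<lambda>A. y A + z A) (v \<oplus>\<^bsub>W\<^esub> w)" if "P y v" "P z w" for y z v w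
    using that by (auto simp: P_def linear_mapD)
  have Psm: "P (\<lambda>A. a * z A) (a \<odot>\<^bsub>W\<^esub> w)" if "P z w" for a z w
    using that by (auto simp: P_def linear_mapD)
  have Ppure: "P (pure_tensor I X x) (f x)" if "x \<in> tuples I X" for x
    using that fc \<phi>f by (auto simp: P_def pure_tensor_def)
  have Pzero: "P (\<lambda>A. 0) \<zero>\<^bsub>W\<^esub>"
  proof -
    have "\<phi> \<zero>\<^bsub>W\<^esub> = 0" if "linear_map W scalars \<phi>" for \<phi>
      using linear_mapD(3)[OF that, of "\<zero>\<^bsub>W\<^esub>" 0] smult_l_null[of "\<zero>\<^bsub>W\<^esub>"] by simp
    then show ?thesis by (simp add: P_def)
  qed
  have ex: "\<exists>w. P z w" if "z \<in> carrier ?T" for z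
    using that
  proof (induction rule: tensor_space_induct)
    case (add z c x)
    then show ?case using Padd[OF _ Psm[OF Ppure]] by blast
  qed (use Pzero in blast)
  have uniq: "v = w" if vw: "P z v" "P z w" for z v w
  proof (rule ccontr)
    assume "v \<noteq> w"
    have vwc: "v \<in> carrier W" "w \<in> carrier W"
      using vw by (auto simp: P_def)
    then have eq: "v = (v \<ominus>\<^bsub>W\<^esub> w) \<oplus>\<^bsub>W\<^esub> w"
      by (simp add: a_minus_def M.a_assoc M.l_neg)
    have "v \<ominus>\<^bsub>W\<^esub> w \<noteq> \<zero>\<^bsub>W\<^esub>"
    proof
      assume "v \<ominus>\<^bsub>W\<^esub> w = \<zero>\<^bsub>W\<^esub>"
      with eq vwc have "v = w" by (metis M.l_zero)
      with \<open>v \<noteq> w\<close> show False ..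
    qed
    then obtain \<phi> where \<phi>: "linear_map W scalars \<phi>" "\<phi> (v \<ominus>\<^bsub>W\<^esub> w) \<noteq> 0"
      using linear_functional_separates[OF W, of "v \<ominus>\<^bsub>W\<^esub> w"] vwc by auto
    have "\<phi> v = \<phi> (v \<ominus>\<^bsub>W\<^esub> w) + \<phi> w"
      using linear_mapD(2)[OF \<phi>(1), of "v \<ominus>\<^bsub>W\<^esub> w" w] vwc eq by simp
    moreover have "\<phi> v = \<phi> w"
      using vw \<phi>(1) unfolding P_def by metis
    ultimately show False using \<phi>(2) by simp
  qed
  define h where "h z = (THE w. P z w)" for z
  have hI: "h z = w" if "P z w" for z w
    unfolding h_def using that uniq by (intro the_equality)
  have h: "P z (h z)" if "z \<in> carrier ?T" for z
    using ex[OF that] hI by metis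
  have lin: "linear_map ?T W h"
    unfolding linear_map_def
  proof (intro conjI ballI allI)
    show "h \<in> carrier ?T \<rightarrow> carrier W" using h by (auto simp: P_def)
  qed (auto intro!: hI Padd Psm h)
  have pure: "h (pure_tensor I X x) = f x" if "x \<in> tuples I X" for x
    using hI Ppure that by blast
  have "h' z = h z" if h': "linear_map ?T W h'" "\<forall>x\<in>tuples I X. h' (pure_tensor I X x) = f x"
    and z: "z \<in> carrier ?T" for h' z
    using z
  proof (induction rule: tensor_space_induct)
    case zero
    have "g (\<lambda>A. 0) = \<zero>\<^bsub>W\<^esub>" if "linear_map ?T W g" for g
      using linear_mapD(1)[OF that zero_in_tensor_space] linear_mapD(3)[OF that zero_in_tensor_space, of 0]
        smult_l_null by simp
    then show ?case using h' lin by metis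
  next
    case (add z c x)
    have step: "g (\<lambda>A. z A + c * pure_tensor I X x A) = g z \<oplus>\<^bsub>W\<^esub> c \<odot>\<^bsub>W\<^esub> g (pure_tensor I X x)"
      if "linear_map ?T W g" for g
      using linear_mapD(2)[OF that add(1) tensor_space_smult[OF pure_in_tensor_space[OF add(2)]], of c]
        linear_mapD(3)[OF that pure_in_tensor_space[OF add(2)], of c] by simp
    show ?case
      using step[OF h'(1)] step[OF lin] h'(2) pure[OF add(2)] add(2,3) by simp
  qed
  then show ?thesis using lin pure by blast
qed

end

theory Submission
  imports Defs "Jordan_Normal_Form.Determinant"
begin

text \<open>The tensor \<open>a\<otimes>a\<otimes>b + a\<otimes>b\<otimes>a + b\<otimes>a\<otimes>a\<close> is the limit as \<open>c \<rightarrow> 0\<close> of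
  \<open>((a + cb)\<otimes>(a + cb)\<otimes>(a + cb) - a\<otimes>a\<otimes>a) / c\<close>, which has rank at most \<open>2\<close>. Adding \<open>r - 2\<close> diagonal
  terms in independent directions gives a limit \<open>z\<close> of tensors of rank at most \<open>r\<close>. The
  rank of \<open>z\<close> is greater than \<open>r\<close>: a decomposition into \<open>r\<close> pure tensors writes the contractions of
  \<open>z\<close> along the third factor as matrices \<open>P D Q\<close> with \<open>D\<close> diagonal and \<open>P\<close>, \<open>Q\<close> square and
  fixed. One contraction \<open>M\<close> is invertible, hence so are \<open>P\<close> and \<open>Q\<close>, and all products of a contraction
  with \<open>M\<^sup>-\<^sup>1\<close> are diagonalised by \<open>P\<close>; but one of them is nilpotent and nonzero.\<close>

section \<open>Linear algebra: an obstruction to simultaneous diagonalisation\<close>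

text \<open>For square matrices over a field a right inverse is also a left inverse. The form with
  entries and sums fits the tensor coefficients below.\<close>

lemma right_inverse_imp_left_inverse_sum:
  fixes a b :: "nat \<Rightarrow> nat \<Rightarrow> 'k::field"
  assumes "\<And>p q. \<lbrakk>p < r; q < r\<rbrakk> \<Longrightarrow> (\<Sum>j<r. a p j * b j q) = (if p = q then 1 else 0)"
    and "j < r" "k < r"
  shows "(\<Sum>p<r. b j p * a p k) = (if j = k then 1 else 0)"
proof -
  define P where "P = mat r r (\<lambda>(p, j). a p j)"
  define Q where "Q = mat r r (\<lambda>(j, q). b j q)"
  have [simp]: "P \<in> carrier_mat r r" "Q \<in> carrier_mat r r"
    by (simp_all add: P_def Q_def)
  have "P * Q = 1\<^sub>m r"
    by (rule eq_matI) (auto simp: P_def Q_def scalar_prod_def atLeast0LessThan assms(1))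
  then have "Q * P = 1\<^sub>m r"
    by (intro mat_mult_left_right_inverse[of P]) simp_all
  then have "(Q * P) $$ (j, k) = 1\<^sub>m r $$ (j, k)"
    by simp
  then show ?thesis
    using assms(2,3) by (simp add: P_def Q_def scalar_prod_def atLeast0LessThan)
qed

text \<open>Up to exchanging the columns \<open>0\<close> and \<open>1\<close>, the first matrix is the identity and the second is
  nilpotent.\<close>

lemma no_simultaneous_diagonalisation:
  fixes x y :: "nat \<Rightarrow> nat \<Rightarrow> 'k::field" and d e :: "nat \<Rightarrow> 'k"
  assumes "r \<ge> 2"
    and D: "\<And>p q. \<lbrakk>p < r; q < r\<rbrakk> \<Longrightarrow>
      (\<Sum>j<r. x j p * y j q * d j) = (if p = Transposition.transpose 0 1 q then 1 else 0)"
    and E: "\<And>p q. \<lbrakk>p < r; q < r\<rbrakk> \<Longrightarrow>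
      (\<Sum>j<r. x j p * y j q * e j) = (if p = 0 \<and> q = 0 then 1 else 0)"
  shows False
proof -
  \<comment> \<open>Exchanging the columns 0 and 1 turns the right side of \<open>D\<close> into the
    identity and that of \<open>E\<close> into the matrix unit at (0, 1), whose square is
    zero.\<close>
  define y' where "y' j q = y j (Transposition.transpose 0 1 q)" for j q
  have tr: "Transposition.transpose 0 1 q < r" if "q < r" for q :: nat
    using that \<open>r \<ge> 2\<close> by (auto simp: Transposition.transpose_def)
  have D': "(\<Sum>j<r. x j p * (y' j q * d j)) = (if p = q then 1 else 0)" if "p < r" "q < r" for p q
    using D[OF that(1) tr[OF that(2)]] by (simp add: y'_def mult.assoc)
  have E': "(\<Sum>j<r. x j p * y' j q * e j) = (if p = 0 \<and> q = 1 then 1 else 0)"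
    if "p < r" "q < r" for p q
    using E[OF that(1) tr[OF that(2)]] by (auto simp: y'_def Transposition.transpose_def)
  \<comment> \<open>By \<open>D'\<close> the transpose of \<open>x\<close> has the right inverse
    with entries \<open>y' j q * d j\<close>. That this is also a left inverse says that
    \<open>Z\<close> is diagonal with entries \<open>1 / d j\<close>.\<close>
  define Z where "Z j k = (\<Sum>p<r. y' j p * x k p)" for j k
  have dZ: "d j * Z j k = (if j = k then 1 else 0)" if "j < r" "k < r" for j k
  proof -
    have "d j * Z j k = (\<Sum>p<r. y' j p * d j * x k p)"
      by (simp add: Z_def sum_distrib_left mult_ac)
    then show ?thesis
      using right_inverse_imp_left_inverse_sum[where a = "\<lambda>p j. x j p", OF D' that] by simp
  qed
  have Z0: "Z j k = 0" if "j < r" "k < r" "j \<noteq> k" for j k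
    using dZ[of j k] dZ[of j j] that by auto
  have Zn: "Z j j \<noteq> 0" if "j < r" for j
    using dZ[of j j] that by auto
  \<comment> \<open>This is \<open>E'\<close> multiplied on the left by \<open>y'\<close>. As
    \<open>Z\<close> is diagonal, row \<open>k\<close> of \<open>y'\<close> is a left eigenvector of
    the nilpotent matrix, with eigenvalue \<open>Z k k * e k\<close>.\<close>
  have key: "Z k k * e k * y' k q = (if q = 1 then y' k 0 else 0)" if k: "k < r" and q: "q < r" for k q
  proof -
    have "(if q = 1 then y' k 0 else 0) = (\<Sum>p<r. y' k p * (if p = 0 \<and> q = 1 then 1 else 0))"
      using \<open>r \<ge> 2\<close> by (auto simp: if_distrib sum.delta cong: if_cong)
    also have "\<dots> = (\<Sum>p<r. \<Sum>j<r. y' k p * x j p * (y' j q * e j))"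
    proof (rule sum.cong)
      fix p assume "p \<in> {..<r}"
      then show "y' k p * (if p = 0 \<and> q = 1 then 1 else 0) = (\<Sum>j<r. y' k p * x j p * (y' j q * e j))"
        by (subst E'[symmetric]) (use q in \<open>simp_all add: sum_distrib_left mult_ac\<close>)
    qed simp
    also have "\<dots> = (\<Sum>j<r. Z k j * (y' j q * e j))"
      by (subst sum.swap) (simp add: Z_def sum_distrib_right)
    also have "\<dots> = (\<Sum>j<r. if j = k then Z k k * (y' k q * e k) else 0)"
      by (rule sum.cong) (use k in \<open>auto simp: Z0\<close>)
    also have "\<dots> = Z k k * (y' k q * e k)"
      using k by simp
    finally show ?thesis
      by (simp add: mult_ac)
  qed
  \<comment> \<open>Column 0 of \<open>key\<close> gives \<open>e k * y' k 0 = 0\<close>. Column 1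
    multiplied by \<open>e k\<close> then shows that every summand of the entry (0, 1) in
    \<open>E'\<close> vanishes, although this entry is 1.\<close>
  have "y' k 1 * e k = 0" if k: "k < r" for k
  proof -
    have "e k * y' k 0 = 0"
      using key[OF k, of 0] Zn[OF k] \<open>r \<ge> 2\<close> by simp
    then have "e k * (Z k k * e k * y' k 1) = 0"
      using key[OF k, of 1] \<open>r \<ge> 2\<close> by simp
    then show ?thesis
      using Zn[OF k] by auto
  qed
  then have "(\<Sum>j<r. x j 0 * y' j 1 * e j) = 0"
    by (intro sum.neutral) (simp add: mult.assoc)
  then show False
    using E'[of 0 1] \<open>r \<ge> 2\<close> by simp
qed

section \<open>Biorthogonal systems in infinite-dimensional spaces\<close>

lemma linear_map_finsum:
  assumes V: "Module.module scalars V" and h: "linear_map V scalars h"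
    and "finite B" "B \<subseteq> carrier V"
  shows "h (\<Oplus>\<^bsub>V\<^esub>b\<in>B. c b \<odot>\<^bsub>V\<^esub> b) = (\<Sum>b\<in>B. c b * h b)"
proof -
  interpret Module.module scalars V by fact
  have cl: "a \<odot>\<^bsub>V\<^esub> v \<in> carrier V" if "v \<in> carrier V" for a v
    using smult_closed[of a v] that by simp
  show ?thesis
    using assms(3,4)
  proof (induction B)
    case empty
    show ?case
      using linear_mapD(3)[OF h, of "\<zero>\<^bsub>V\<^esub>" 0] smult_l_null[of "\<zero>\<^bsub>V\<^esub>"] by simp
  next
    case (insert b B)
    then have "(\<lambda>b. c b \<odot>\<^bsub>V\<^esub> b) \<in> B \<rightarrow> carrier V"
      using cl by blast
    then show ?case
      using insert cl[of b] linear_mapD(2)[OF h] linear_mapD(3)[OF h, of b] M.finsum_closed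
      by simp
  qed
qed

text \<open>Induction in the manner of Gram-Schmidt: some vector lies outside the span of
  \<open>B\<close>, and both this vector and a functional that does not vanish at the result are
  corrected against the pairs found so far.\<close>

lemma biorthogonal_set_exists:
  fixes V :: "('k::field, 'a) module"
  assumes V: "Module.module scalars V" and inf: "\<not> finite_dimensional V"
  shows "\<exists>B \<phi>. finite B \<and> card B = m \<and> B \<subseteq> carrier V \<and> (\<forall>b\<in>B. linear_map V scalars (\<phi> b)) \<and>
    (\<forall>b\<in>B. \<forall>b'\<in>B. \<phi> b b' = (if b = b' then 1 else 0))"
proof (induction m)
  case 0
  show ?case by (intro exI[of _ "{}"]) simp
next
  case (Suc m)
  interpret Module.module scalars V by fact
  obtain B \<phi> where B: "finite B" "card B = m" "B \<subseteq> carrier V"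
    and lin: "\<And>b. b \<in> B \<Longrightarrow> linear_map V scalars (\<phi> b)"
    and dual: "\<And>b b'. \<lbrakk>b \<in> B; b' \<in> B\<rbrakk> \<Longrightarrow> \<phi> b b' = (if b = b' then 1 else 0)"
    using Suc.IH by blast
  obtain v where v: "v \<in> carrier V" and nspan: "\<And>c. v \<noteq> (\<Oplus>\<^bsub>V\<^esub>b\<in>B. c b \<odot>\<^bsub>V\<^esub> b)"
    using inf B unfolding finite_dimensional_def by blast
  \<comment> \<open>The projection of \<open>v\<close> to the span of \<open>B\<close> along the
    common kernel of the functionals; subtracting it makes all of them vanish at
    \<open>w\<close>.\<close>
  define s where "s = (\<Oplus>\<^bsub>V\<^esub>b\<in>B. \<phi> b v \<odot>\<^bsub>V\<^esub> b)"
  have s: "s \<in> carrier V"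
    unfolding s_def using B smult_closed by (intro M.finsum_closed) auto
  define w where "w = v \<ominus>\<^bsub>V\<^esub> s"
  have w: "w \<in> carrier V"
    using v s by (simp add: w_def)
  have vws: "v = w \<oplus>\<^bsub>V\<^esub> s"
    using v s by (simp add: w_def a_minus_def M.a_assoc M.l_neg)
  have "w \<noteq> \<zero>\<^bsub>V\<^esub>"
  proof
    assume "w = \<zero>\<^bsub>V\<^esub>"
    then have "v = s" using vws s by simp
    then show False using nspan[of "\<lambda>b. \<phi> b v"] unfolding s_def by contradiction
  qed
  then obtain \<psi> where \<psi>: "linear_map V scalars \<psi>" "\<psi> w \<noteq> 0"
    using linear_functional_separates[OF V w] by blast
  have \<phi>w: "\<phi> b w = 0" if b: "b \<in> B" for b
  proof -
    have "\<phi> b s = (\<Sum>b'\<in>B. \<phi> b' v * \<phi> b b')"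
      unfolding s_def by (rule linear_map_finsum[OF V lin[OF b] B(1,3)])
    also have "\<dots> = (\<Sum>b'\<in>B. if b' = b then \<phi> b v else 0)"
      using dual b by (intro sum.cong) auto
    also have "\<dots> = \<phi> b v"
      using b B by simp
    finally show ?thesis
      using linear_mapD(2)[OF lin[OF b] w s] vws by simp
  qed
  \<comment> \<open>The correction makes \<open>\<psi>\<close> vanish on \<open>B\<close> and keeps
    its value at \<open>w\<close>, because every \<open>\<phi> b w\<close> is 0; the divisor
    normalises that value to 1.\<close>
  define \<eta> where "\<eta> u = (\<psi> u - (\<Sum>b\<in>B. \<psi> b * \<phi> b u)) / \<psi> w" for u
  have "linear_map V scalars \<eta>"
    unfolding linear_map_def
  proof (intro conjI ballI allI)
    fix x y assume xy: "x \<in> carrier V" "y \<in> carrier V"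
    have "(\<Sum>b\<in>B. \<psi> b * \<phi> b (x \<oplus>\<^bsub>V\<^esub> y)) = (\<Sum>b\<in>B. \<psi> b * \<phi> b x + \<psi> b * \<phi> b y)"
      using linear_mapD(2)[OF lin xy] by (intro sum.cong) (simp_all add: distrib_left)
    then show "\<eta> (x \<oplus>\<^bsub>V\<^esub> y) = \<eta> x \<oplus>\<^bsub>scalars\<^esub> \<eta> y"
      using linear_mapD(2)[OF \<psi>(1) xy]
      by (simp add: \<eta>_def sum.distrib add_divide_distrib diff_divide_distrib)
  next
    fix a x assume x: "x \<in> carrier V"
    have "(\<Sum>b\<in>B. \<psi> b * \<phi> b (a \<odot>\<^bsub>V\<^esub> x)) = (\<Sum>b\<in>B. a * (\<psi> b * \<phi> b x))"
      using linear_mapD(3)[OF lin x] by (intro sum.cong) simp_all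
    then show "\<eta> (a \<odot>\<^bsub>V\<^esub> x) = a \<odot>\<^bsub>scalars\<^esub> \<eta> x"
      using linear_mapD(3)[OF \<psi>(1) x]
      by (simp add: \<eta>_def right_diff_distrib flip: sum_distrib_left)
  qed simp
  moreover have "\<eta> b = 0" if b: "b \<in> B" for b
  proof -
    have "(\<Sum>b'\<in>B. \<psi> b' * \<phi> b' b) = (\<Sum>b'\<in>B. if b' = b then \<psi> b else 0)"
      using dual b by (intro sum.cong) auto
    then show ?thesis
      using b B by (simp add: \<eta>_def)
  qed
  moreover have "\<eta> w = 1"
    using \<psi>(2) \<phi>w by (simp add: \<eta>_def)
  moreover have "w \<notin> B"
    using \<phi>w[of w] dual[of w w] by auto
  ultimately have "\<forall>b\<in>insert w B. linear_map V scalars ((\<phi>(w := \<eta>)) b)"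
    "\<forall>b\<in>insert w B. \<forall>b'\<in>insert w B. (\<phi>(w := \<eta>)) b b' = (if b = b' then 1 else 0)"
    "card (insert w B) = Suc m"
    using B lin dual \<phi>w by auto
  then show ?case
    using B w by blast
qed

lemma biorthogonal_system_exists:
  fixes V :: "('k::field, 'a) module"
  assumes "Module.module scalars V" "\<not> finite_dimensional V"
  shows "\<exists>(u :: nat \<Rightarrow> 'a) \<phi>. (\<forall>q<m. u q \<in> carrier V \<and> linear_map V scalars (\<phi> q)) \<and>
    (\<forall>p<m. \<forall>q<m. \<phi> p (u q) = (if p = q then 1 else 0))"
proof -
  obtain B \<phi> where B: "finite B" "card B = m" "B \<subseteq> carrier V"
    and lin: "\<And>b. b \<in> B \<Longrightarrow> linear_map V scalars (\<phi> b)"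
    and dual: "\<And>b b'. \<lbrakk>b \<in> B; b' \<in> B\<rbrakk> \<Longrightarrow> \<phi> b b' = (if b = b' then 1 else 0)"
    using biorthogonal_set_exists[OF assms, of m] by blast
  obtain u where u: "bij_betw u {0..<m} B"
    using ex_bij_betw_nat_finite[OF B(1)] B(2) by blast
  then have uB: "u q \<in> B" if "q < m" for q
    using that by (auto simp: bij_betw_def)
  have "u p = u q \<longleftrightarrow> p = q" if "p < m" "q < m" for p q
    using u that by (auto simp: bij_betw_def inj_on_def)
  then show ?thesis
    using uB B(3) lin dual by (intro exI[of _ u] exI[of _ "\<lambda>q. \<phi> (u q)"]) auto
qed

section \<open>Multilinear expansion in three slots\<close>

lemma multilinear_mapD:
  assumes "multilinear_map I X W A" "x \<in> tuples I X" "i \<in> I" "v \<in> carrier (X i)" "w \<in> carrier (X i)"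
  shows "A (x(i := v \<oplus>\<^bsub>X i\<^esub> w)) = A (x(i := v)) \<oplus>\<^bsub>W\<^esub> A (x(i := w))"
    and "A (x(i := a \<odot>\<^bsub>X i\<^esub> v)) = a \<odot>\<^bsub>W\<^esub> A (x(i := v))"
  using assms by (auto simp: multilinear_map_def linear_map_def)

text \<open>The difference quotient, with its factor \<open>1 / c\<close> absorbed in the slot \<open>i\<close>.\<close>

lemma multilinear_difference_quotient:
  fixes X :: "'i \<Rightarrow> ('k::field, 'a) module"
  assumes V: "\<And>l. l \<in> {i, j, k} \<Longrightarrow> Module.module scalars (X l)"
    and A: "multilinear_map I X scalars A" and x: "x \<in> tuples I X"
    and ijk: "i \<in> I" "j \<in> I" "k \<in> I" "i \<noteq> j" "i \<noteq> k" "j \<noteq> k"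
    and a: "\<And>l. l \<in> {i, j, k} \<Longrightarrow> a l \<in> carrier (X l)"
    and b: "\<And>l. l \<in> {i, j, k} \<Longrightarrow> b l \<in> carrier (X l)"
    and c: "c \<noteq> 0"
  defines "G \<equiv> \<lambda>u v w. A (x(i := u, j := v, k := w))"
  shows "G ((1 / c) \<odot>\<^bsub>X i\<^esub> a i \<oplus>\<^bsub>X i\<^esub> b i) (a j \<oplus>\<^bsub>X j\<^esub> c \<odot>\<^bsub>X j\<^esub> b j) (a k \<oplus>\<^bsub>X k\<^esub> c \<odot>\<^bsub>X k\<^esub> b k)
      + G ((- (1 / c)) \<odot>\<^bsub>X i\<^esub> a i) (a j) (a k)
    = G (b i) (a j) (a k) + G (a i) (b j) (a k) + G (a i) (a j) (b k)
      + c * (G (a i) (b j) (b k) + G (b i) (a j) (b k) + G (b i) (b j) (a k))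
      + c * c * G (b i) (b j) (b k)"
proof -
  have sm: "s \<odot>\<^bsub>X l\<^esub> v \<in> carrier (X l)" if "l \<in> {i, j, k}" "v \<in> carrier (X l)" for s l v
    using module.smult_closed[OF V[OF that(1)], of s v] that(2) by simp
  have ad: "u \<oplus>\<^bsub>X l\<^esub> v \<in> carrier (X l)" if "l \<in> {i, j, k}" "u \<in> carrier (X l)" "v \<in> carrier (X l)" for l u v
  proof -
    interpret Module.module scalars "X l" by (rule V[OF that(1)])
    show ?thesis using that by simp
  qed
  \<comment> \<open>Updates at distinct indices commute, so each of the three slots can be made the
    last update, where multilinearity applies.\<close>
  have 1: "G (s \<odot>\<^bsub>X i\<^esub> u) v w = s * G u v w"
      "u' \<in> carrier (X i) \<Longrightarrow> G (u \<oplus>\<^bsub>X i\<^esub> u') v w = G u v w + G u' v w"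
    if "u \<in> carrier (X i)" "v \<in> carrier (X j)" "w \<in> carrier (X k)" for u u' v w s
  proof -
    have "x(j := v, k := w) \<in> tuples I X"
      using that x ijk by (intro tuples_upd) auto
    note lin = multilinear_mapD[OF A this ijk(1) that(1)]
    from lin(2)[OF that(1)] show "G (s \<odot>\<^bsub>X i\<^esub> u) v w = s * G u v w"
      using ijk by (simp add: G_def fun_upd_twist)
    show "G (u \<oplus>\<^bsub>X i\<^esub> u') v w = G u v w + G u' v w" if "u' \<in> carrier (X i)"
      using lin(1)[OF that]
      using ijk by (simp add: G_def fun_upd_twist)
  qed
  have 2: "G u (s \<odot>\<^bsub>X j\<^esub> v) w = s * G u v w"
      "v' \<in> carrier (X j) \<Longrightarrow> G u (v \<oplus>\<^bsub>X j\<^esub> v') w = G u v w + G u v' w"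
    if "u \<in> carrier (X i)" "v \<in> carrier (X j)" "w \<in> carrier (X k)" for u v v' w s
  proof -
    have "x(i := u, k := w) \<in> tuples I X"
      using that x ijk by (intro tuples_upd) auto
    note lin = multilinear_mapD[OF A this ijk(2) that(2)]
    from lin(2)[OF that(2)] show "G u (s \<odot>\<^bsub>X j\<^esub> v) w = s * G u v w"
      using ijk by (simp add: G_def fun_upd_twist)
    show "G u (v \<oplus>\<^bsub>X j\<^esub> v') w = G u v w + G u v' w" if "v' \<in> carrier (X j)"
      using lin(1)[OF that]
      using ijk by (simp add: G_def fun_upd_twist)
  qed
  have 3: "G u v (s \<odot>\<^bsub>X k\<^esub> w) = s * G u v w"
      "w' \<in> carrier (X k) \<Longrightarrow> G u v (w \<oplus>\<^bsub>X k\<^esub> w') = G u v w + G u v w'"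
    if "u \<in> carrier (X i)" "v \<in> carrier (X j)" "w \<in> carrier (X k)" for u v w w' s
  proof -
    have "x(i := u, j := v) \<in> tuples I X"
      using that x ijk by (intro tuples_upd) auto
    note lin = multilinear_mapD[OF A this ijk(3) that(3)]
    from lin(2)[OF that(3)] show "G u v (s \<odot>\<^bsub>X k\<^esub> w) = s * G u v w"
      by (simp add: G_def)
    show "G u v (w \<oplus>\<^bsub>X k\<^esub> w') = G u v w + G u v w'" if "w' \<in> carrier (X k)"
      using lin(1)[OF that] by (simp add: G_def)
  qed
  \<comment> \<open>The only term with a negative power of \<open>c\<close> is
    \<open>G (a i) (a j) (a k)\<close> divided by \<open>c\<close>, and the second summand on the
    left cancels it.\<close>
  show ?thesis
    using a b c by (simp add: 1 2 3 sm ad field_simps)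
qed


section \<open>The border tensor, its rank and its approximations\<close>

locale biorthogonal_family =
  fixes I :: "'i set" and X :: "'i \<Rightarrow> ('k::field, 'a) module"
    and u :: "'i \<Rightarrow> nat \<Rightarrow> 'a" and \<phi> :: "'i \<Rightarrow> nat \<Rightarrow> 'a \<Rightarrow> 'k"
    and i j k :: 'i and r :: nat
  assumes finite_I: "finite I"
    and ijk: "i \<in> I" "j \<in> I" "k \<in> I" "i \<noteq> j" "i \<noteq> k" "j \<noteq> k"
    and r_ge_2: "r \<ge> 2"
    and module_X: "l \<in> I \<Longrightarrow> Module.module scalars (X l)"
    and u_closed: "\<lbrakk>l \<in> I; q < r\<rbrakk> \<Longrightarrow> u l q \<in> carrier (X l)"
    and \<phi>_linear: "\<lbrakk>l \<in> I; q < r\<rbrakk> \<Longrightarrow> linear_map (X l) scalars (\<phi> l q)"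
    and \<phi>_u: "\<lbrakk>l \<in> I; p < r; q < r\<rbrakk> \<Longrightarrow> \<phi> l p (u l q) = (if p = q then 1 else 0)"
begin

text \<open>Holding the remaining factors at \<open>u l 0\<close> embeds tensors of order three into
  tensors over all of \<open>I\<close>.\<close>

definition slots :: "'a \<Rightarrow> 'a \<Rightarrow> 'a \<Rightarrow> 'i \<Rightarrow> 'a" where
  "slots v\<^sub>1 v\<^sub>2 v\<^sub>3 = (\<lambda>l\<in>I. u l 0)(i := v\<^sub>1, j := v\<^sub>2, k := v\<^sub>3)"

abbreviation basis_tensor :: "nat \<Rightarrow> nat \<Rightarrow> nat \<Rightarrow> (('i \<Rightarrow> 'a) \<Rightarrow> 'k) \<Rightarrow> 'k" where
  "basis_tensor p q s \<equiv> pure_tensor I X (slots (u i p) (u j q) (u k s))"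

definition dual_form :: "nat \<Rightarrow> nat \<Rightarrow> nat \<Rightarrow> ('i \<Rightarrow> 'a) \<Rightarrow> 'k" where
  "dual_form p q s = (\<lambda>x. \<Prod>l\<in>I. ((\<lambda>l. \<phi> l 0)(i := \<phi> i p, j := \<phi> j q, k := \<phi> k s)) l (x l))"

text \<open>The limit tensor with a = \<open>u l 0\<close> and b = \<open>u l 1\<close>; for
  \<open>r = 2\<close> its coefficients are those of the W state of quantum information.\<close>

definition border_tensor :: "(('i \<Rightarrow> 'a) \<Rightarrow> 'k) \<Rightarrow> 'k" where
  "border_tensor = (\<lambda>A. basis_tensor 1 0 0 A + basis_tensor 0 1 0 A + basis_tensor 0 0 1 A
     + (\<Sum>q\<in>{2..<r}. basis_tensor q q q A))"

lemma slots_in_tuples: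
  "\<lbrakk>v\<^sub>1 \<in> carrier (X i); v\<^sub>2 \<in> carrier (X j); v\<^sub>3 \<in> carrier (X k)\<rbrakk> \<Longrightarrow> slots v\<^sub>1 v\<^sub>2 v\<^sub>3 \<in> tuples I X"
proof -
  assume v: "v\<^sub>1 \<in> carrier (X i)" "v\<^sub>2 \<in> carrier (X j)" "v\<^sub>3 \<in> carrier (X k)"
  have "(\<lambda>l\<in>I. u l 0) \<in> tuples I X"
    using r_ge_2 by (auto intro: u_closed)
  then show ?thesis
    unfolding slots_def using ijk v by (intro tuples_upd)
qed

lemma basis_tensor_closed:
  "\<lbrakk>p < r; q < r; s < r\<rbrakk> \<Longrightarrow> basis_tensor p q s \<in> carrier (tensor_space I X)"
  using ijk by (intro pure_in_tensor_space slots_in_tuples u_closed)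

text \<open>The factors outside the three slots are grouped with slot \<open>k\<close>, which gives
  the three-factor products used in the rank bound.\<close>

lemma dual_form_eq:
  "dual_form p q s x = \<phi> i p (x i) * \<phi> j q (x j) * (\<phi> k s (x k) * (\<Prod>l\<in>I - {i, j, k}. \<phi> l 0 (x l)))"
proof -
  let ?f = "\<lambda>l. ((\<lambda>l. \<phi> l 0)(i := \<phi> i p, j := \<phi> j q, k := \<phi> k s)) l (x l)"
  have "(\<Prod>l\<in>I. ?f l) = (\<Prod>l\<in>I - {i, j, k}. ?f l) * (\<Prod>l\<in>{i, j, k}. ?f l)"
    using finite_I ijk by (intro prod.subset_diff) auto
  also have "(\<Prod>l\<in>I - {i, j, k}. ?f l) = (\<Prod>l\<in>I - {i, j, k}. \<phi> l 0 (x l))"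
    by (rule prod.cong) auto
  also have "(\<Prod>l\<in>{i, j, k}. ?f l) = \<phi> i p (x i) * \<phi> j q (x j) * \<phi> k s (x k)"
    using ijk by simp
  finally show ?thesis
    by (simp only: dual_form_def mult_ac)
qed

lemma multilinear_dual_form:
  assumes "p < r" "q < r" "s < r"
  shows "multilinear_map I X scalars (dual_form p q s)"
proof -
  have "linear_map (X l) scalars (((\<lambda>l. \<phi> l 0)(i := \<phi> i p, j := \<phi> j q, k := \<phi> k s)) l)"
    if "l \<in> I" for l
    using that assms r_ge_2 ijk by (simp add: \<phi>_linear)
  then show ?thesis
    unfolding dual_form_def by (rule multilinear_prod[OF finite_I])
qed

lemma basis_tensor_dual_form:
  assumes "p < r" "q < r" "s < r" "p' < r" "q' < r" "s' < r"
  shows "basis_tensor p' q' s' (dual_form p q s) = (if p = p' \<and> q = q' \<and> s = s' then 1 else 0)"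
proof -
  have "(\<Prod>l\<in>I - {i, j, k}. \<phi> l 0 (slots (u i p') (u j q') (u k s') l)) = 1"
    using r_ge_2 by (intro prod.neutral) (auto simp: slots_def \<phi>_u)
  then show ?thesis
    using assms ijk multilinear_dual_form[of p q s]
    by (simp add: pure_tensor_def dual_form_eq) (simp add: slots_def \<phi>_u)
qed

text \<open>For fixed \<open>s\<close> these are the entries of a contraction along slot
  \<open>k\<close>: the exchange of 0 and 1 for \<open>s = 0\<close>, and a diagonal matrix unit
  otherwise, at 0 for \<open>s = 1\<close> and at \<open>s\<close> for larger
  \<open>s\<close>.\<close>

lemma border_tensor_dual_form:
  assumes "p < r" "q < r" "s < r"
  shows "border_tensor (dual_form p q s) =
    (if s = 0 then if p = 1 \<and> q = 0 \<or> p = 0 \<and> q = 1 then 1 else 0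
     else if s = 1 then if p = 0 \<and> q = 0 then 1 else 0
     else if p = s \<and> q = s then 1 else 0)"
proof -
  have "(\<Sum>m\<in>{2..<r}. basis_tensor m m m (dual_form p q s))
      = (\<Sum>m\<in>{2..<r}. if m = s then if p = s \<and> q = s then 1 else 0 else 0)"
    using assms by (intro sum.cong) (auto simp: basis_tensor_dual_form)
  then show ?thesis
    using assms r_ge_2 by (auto simp: border_tensor_def basis_tensor_dual_form)
qed

lemma border_tensor_closed: "border_tensor \<in> carrier (tensor_space I X)"
proof -
  have "(\<lambda>A. \<Sum>q\<in>B. basis_tensor q q q A) \<in> carrier (tensor_space I X)" if "finite B" "B \<subseteq> {..<r}" for B
    using that
  proof (induction B)
    case (insert q B)
    then show ?case
      using tensor_space_add[of "\<lambda>A. \<Sum>q\<in>B. basis_tensor q q q A" I X "basis_tensor q q q"]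
      by (simp add: basis_tensor_closed)
  qed (simp add: zero_in_tensor_space)
  then have "(\<lambda>A. \<Sum>q\<in>{2..<r}. basis_tensor q q q A) \<in> carrier (tensor_space I X)"
    by (simp add: subset_eq)
  then show ?thesis
    unfolding border_tensor_def using r_ge_2
    by (intro tensor_space_add basis_tensor_closed) simp_all
qed

lemma border_tensor_rank: "border_tensor \<notin> rank_le r I X"
proof
  assume "border_tensor \<in> rank_le r I X"
  then obtain m x where m: "m \<le> r"
    and z: "border_tensor = (\<lambda>A. \<Sum>t<m. pure_tensor I X (x t) A)"
    using rank_le_iff[of I X border_tensor r] module_X ijk by blast
  \<comment> \<open>The value 0 from \<open>m\<close> on pads the decomposition to exactly
    \<open>r\<close> terms, so that the coefficient matrices are square.\<close>
  define a where "a t p = (if t < m then \<phi> i p (x t i) else 0)" for t p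
  define b where "b t q = \<phi> j q (x t j)" for t q
  define w where "w t s = \<phi> k s (x t k) * (\<Prod>l\<in>I - {i, j, k}. \<phi> l 0 (x t l))" for t s
  have val: "(\<Sum>t<r. a t p * b t q * w t s) = border_tensor (dual_form p q s)"
    if "p < r" "q < r" "s < r" for p q s
  proof -
    have "border_tensor (dual_form p q s) = (\<Sum>t<m. a t p * b t q * w t s)"
      unfolding z using multilinear_dual_form[OF that]
      by (intro sum.cong) (auto simp: pure_tensor_def dual_form_eq a_def b_def w_def)
    also have "\<dots> = (\<Sum>t<r. a t p * b t q * w t s)"
      using m by (intro sum.mono_neutral_left) (auto simp: a_def)
    finally show ?thesis ..
  qed
  \<comment> \<open>The sum of all contractions except the one at \<open>s = 1\<close> is the
    permutation matrix exchanging 0 and 1, hence invertible; the contraction at \<open>s = 1\<close>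
    becomes nilpotent after this exchange.\<close>
  define d where "d t = w t 0 + (\<Sum>s\<in>{2..<r}. w t s)" for t
  show False
  proof (rule no_simultaneous_diagonalisation[OF r_ge_2])
    fix p q assume pq: "p < r" "q < r"
    have "(\<Sum>t<r. a t p * b t q * d t)
        = (\<Sum>t<r. a t p * b t q * w t 0) + (\<Sum>s\<in>{2..<r}. \<Sum>t<r. a t p * b t q * w t s)"
      by (subst sum.swap) (simp add: d_def algebra_simps sum.distrib sum_distrib_left)
    also have "\<dots> = border_tensor (dual_form p q 0) + (\<Sum>s\<in>{2..<r}. border_tensor (dual_form p q s))"
      using pq r_ge_2 by (simp add: val)
    also have "(\<Sum>s\<in>{2..<r}. border_tensor (dual_form p q s))
        = (\<Sum>s\<in>{2..<r}. if s = p then if p = q then 1 else 0 else 0)"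
      using pq by (intro sum.cong) (auto simp: border_tensor_dual_form)
    finally show "(\<Sum>t<r. a t p * b t q * d t) = (if p = Transposition.transpose 0 1 q then 1 else 0)"
      using pq r_ge_2 by (auto simp: border_tensor_dual_form Transposition.transpose_def)
    show "(\<Sum>t<r. a t p * b t q * w t 1) = (if p = 0 \<and> q = 0 then 1 else 0)"
      using pq r_ge_2 by (simp add: val border_tensor_dual_form)
  qed
qed

text \<open>The scalars are absorbed in slot \<open>i\<close>, so this is a sum of pure tensors: two
  from the difference quotient and \<open>r - 2\<close> diagonal ones.\<close>

definition border_approx :: "'k \<Rightarrow> (('i \<Rightarrow> 'a) \<Rightarrow> 'k) \<Rightarrow> 'k" where
  "border_approx c = (\<lambda>A.
     pure_tensor I X (slots ((1 / c) \<odot>\<^bsub>X i\<^esub> u i 0 \<oplus>\<^bsub>X i\<^esub> u i 1)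
       (u j 0 \<oplus>\<^bsub>X j\<^esub> c \<odot>\<^bsub>X j\<^esub> u j 1) (u k 0 \<oplus>\<^bsub>X k\<^esub> c \<odot>\<^bsub>X k\<^esub> u k 1)) A
     + pure_tensor I X (slots ((- (1 / c)) \<odot>\<^bsub>X i\<^esub> u i 0) (u j 0) (u k 0)) A
     + (\<Sum>q\<in>{2..<r}. basis_tensor q q q A))"

lemma border_approx_rank: "border_approx c \<in> rank_le r I X"
proof -
  have sm: "s \<odot>\<^bsub>X l\<^esub> v \<in> carrier (X l)" if "l \<in> I" "v \<in> carrier (X l)" for s l v
    using module.smult_closed[OF module_X[OF that(1)], of s v] that(2) by simp
  have ad: "v \<oplus>\<^bsub>X l\<^esub> w \<in> carrier (X l)" if "l \<in> I" "v \<in> carrier (X l)" "w \<in> carrier (X l)" for l v w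
  proof -
    interpret Module.module scalars "X l" by (rule module_X[OF that(1)])
    show ?thesis using that by simp
  qed
  define x where "x t =
    (if t = 0 then slots ((1 / c) \<odot>\<^bsub>X i\<^esub> u i 0 \<oplus>\<^bsub>X i\<^esub> u i 1)
       (u j 0 \<oplus>\<^bsub>X j\<^esub> c \<odot>\<^bsub>X j\<^esub> u j 1) (u k 0 \<oplus>\<^bsub>X k\<^esub> c \<odot>\<^bsub>X k\<^esub> u k 1)
     else if t = 1 then slots ((- (1 / c)) \<odot>\<^bsub>X i\<^esub> u i 0) (u j 0) (u k 0)
     else slots (u i t) (u j t) (u k t))" for t :: nat
  have "x t \<in> tuples I X" if "t < r" for t
    using that ijk r_ge_2 by (simp add: x_def slots_in_tuples ad sm u_closed del: PiE_iff)
  moreover have "border_approx c = (\<lambda>A. \<Sum>t<r. pure_tensor I X (x t) A)"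
  proof
    fix A
    have "{..<r} = insert 0 (insert 1 {2..<r})"
      using r_ge_2 by auto
    then have "(\<Sum>t<r. pure_tensor I X (x t) A)
        = pure_tensor I X (x 0) A + (pure_tensor I X (x 1) A + (\<Sum>t\<in>{2..<r}. pure_tensor I X (x t) A))"
      by simp
    also have "(\<Sum>t\<in>{2..<r}. pure_tensor I X (x t) A) = (\<Sum>q\<in>{2..<r}. basis_tensor q q q A)"
      by (rule sum.cong) (auto simp: x_def)
    finally show "border_approx c A = (\<Sum>t<r. pure_tensor I X (x t) A)"
      by (simp add: x_def border_approx_def add.assoc)
  qed
  ultimately show ?thesis
    using rank_le_iff[of I X "border_approx c" r] module_X ijk by blast
qed

text \<open>Since \<open>P\<close> and \<open>Q\<close> do not depend on \<open>c\<close>,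
  convergence as \<open>c\<close> tends to 0 can be read off in any norm.\<close>

lemma border_approx_expansion:
  obtains P Q where "P \<in> carrier (tensor_space I X)" "Q \<in> carrier (tensor_space I X)"
    "\<And>c. c \<noteq> 0 \<Longrightarrow> border_approx c = (\<lambda>A. border_tensor A + (c * P A + c * c * Q A))"
proof
  let ?P = "\<lambda>A. basis_tensor 0 1 1 A + basis_tensor 1 0 1 A + basis_tensor 1 1 0 A"
  show "?P \<in> carrier (tensor_space I X)" "basis_tensor 1 1 1 \<in> carrier (tensor_space I X)"
    using r_ge_2 by (auto intro!: tensor_space_add basis_tensor_closed)
  fix c :: 'k assume c: "c \<noteq> 0"
  show "border_approx c = (\<lambda>A. border_tensor A + (c * ?P A + c * c * basis_tensor 1 1 1 A))"
  proof
    fix A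
    show "border_approx c A = border_tensor A + (c * ?P A + c * c * basis_tensor 1 1 1 A)"
    \<comment> \<open>At arguments that are not multilinear forms all pure tensors are 0 by
      convention, so both sides vanish.\<close>
    proof (cases "multilinear_map I X scalars A")
      case True
      have "(\<lambda>l\<in>I. u l 0) \<in> tuples I X"
        using r_ge_2 by (auto intro: u_closed)
      moreover have "Module.module scalars (X l)" "u l 0 \<in> carrier (X l)" "u l 1 \<in> carrier (X l)"
        if "l \<in> {i, j, k}" for l
        using that ijk r_ge_2 by (auto intro: module_X u_closed)
      ultimately show ?thesis
        using multilinear_difference_quotient[OF _ True _ ijk _ _ c, of "\<lambda>l\<in>I. u l 0" "\<lambda>l. u l 0" "\<lambda>l. u l 1"] True
        by (simp add: border_approx_def border_tensor_def pure_tensor_def slots_def add.assoc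
            del: fun_upd_apply)
    qed (simp add: border_approx_def border_tensor_def pure_tensor_def)
  qed
qed

end

section \<open>Convergence and the failure of completeness\<close>

text \<open>The triangle inequality and homogeneity bound the distance to \<open>z\<close> by a
  quadratic polynomial in \<open>norm (c m)\<close> without constant term.\<close>

lemma (in normed_space) limitin_norm_quadratic:
  assumes z: "z \<in> carrier V" "P \<in> carrier V" "Q \<in> carrier V" and c: "c \<longlonglongrightarrow> 0"
  shows "limitin (Metric_space.mtopology (carrier V) (norm_dist V N))
    (\<lambda>m. z \<oplus> (c m \<odot> P \<oplus> (c m * c m) \<odot> Q)) z sequentially"
proof -
  interpret Metric_space "carrier V" "norm_dist V N"
    by (rule Metric_space_norm_dist) simp
  have cl: "a \<odot> x \<in> carrier V" if "x \<in> carrier V" for a x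
    using smult_closed[of a x] that by simp
  define y where "y m = c m \<odot> P \<oplus> (c m * c m) \<odot> Q" for m
  have y: "y m \<in> carrier V" for m
    using z cl by (simp add: y_def)
  have bound: "norm_dist V N (z \<oplus> y m) z \<le> norm (c m) * N P + norm (c m * c m) * N Q" for m
  proof -
    have "z \<oplus> y m \<ominus> z = y m"
      using z y[of m] by (simp add: a_minus_def M.a_comm[of z] M.a_assoc M.r_neg)
    then show ?thesis
      using norm_add_le[of "c m \<odot> P" "(c m * c m) \<odot> Q"] z y[of m] cl
      by (simp add: norm_dist_def norm_smult y_def)
  qed
  have "(\<lambda>m. norm (c m) * N P + norm (c m * c m) * N Q) \<longlonglongrightarrow> 0"
    by (auto intro!: tendsto_eq_intros c)
  then have "(\<lambda>m. norm_dist V N (z \<oplus> y m) z) \<longlonglongrightarrow> 0"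
    by (rule tendsto_sandwich[OF _ _ tendsto_const, rotated 2])
      (auto intro!: always_eventually bound)
  then show ?thesis
    using z y by (simp add: limitin_metric_dist_null flip: y_def)
qed

theorem proposition2p11:
  fixes X :: "nat \<Rightarrow> ('k::real_or_complex_field, 'a) module"
    and N :: "nat \<Rightarrow> 'a \<Rightarrow> real"
    and \<alpha> :: "(((nat \<Rightarrow> 'a) \<Rightarrow> 'k) \<Rightarrow> 'k) \<Rightarrow> real"
    and n r :: nat
  assumes "n > 2"
    and "\<And>i. i \<in> {1..n} \<Longrightarrow> banach_space (X i) (N i)"
    and "\<And>i. i \<in> {1..n} \<Longrightarrow> \<not> finite_dimensional (X i)"
    and "reasonable_cross_norm {1..n} X N \<alpha>"
    and "r \<ge> 2"
  shows "\<not> Metric_space.mcomplete (rank_le r {1..n} X) (norm_dist (tensor_space {1..n} X) \<alpha>)"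
proof
  let ?I = "{1..n}" let ?T = "tensor_space ?I X"
  assume complete: "Metric_space.mcomplete (rank_le r ?I X) (norm_dist ?T \<alpha>)"
  interpret T: normed_space ?T \<alpha>
    using assms(4) by (simp add: reasonable_cross_norm_def)
  interpret Submetric "carrier ?T" "norm_dist ?T \<alpha>" "rank_le r ?I X"
    by (intro Submetric.intro Submetric_axioms.intro T.Metric_space_norm_dist) (auto simp: rank_le_def)
  have V: "Module.module scalars (X i)" if "i \<in> ?I" for i
    using assms(2)[OF that] by (simp add: banach_space_def normed_space_def)
  have "\<forall>i\<in>?I. \<exists>u \<phi>. (\<forall>q<r. u q \<in> carrier (X i) \<and> linear_map (X i) scalars (\<phi> q)) \<and>
      (\<forall>p<r. \<forall>q<r. \<phi> p (u q) = (if p = q then 1 else 0))"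
    using biorthogonal_system_exists[OF V assms(3)] by blast
  from bchoice[OF this] obtain u where "\<forall>i\<in>?I. \<exists>\<phi>.
      (\<forall>q<r. u i q \<in> carrier (X i) \<and> linear_map (X i) scalars (\<phi> q)) \<and>
      (\<forall>p<r. \<forall>q<r. \<phi> p (u i q) = (if p = q then 1 else 0))" ..
  from bchoice[OF this] obtain \<phi> where u\<phi>: "\<forall>i\<in>?I.
      (\<forall>q<r. u i q \<in> carrier (X i) \<and> linear_map (X i) scalars (\<phi> i q)) \<and>
      (\<forall>p<r. \<forall>q<r. \<phi> i p (u i q) = (if p = q then 1 else 0))" ..
  \<comment> \<open>The assumption \<open>n > 2\<close> provides the three distinct slots 1, 2 and
    3.\<close>
  interpret biorthogonal_family ?I X u \<phi> 1 2 3 r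
    using assms(1,5) u\<phi> by (intro biorthogonal_family.intro V) simp_all
  obtain P Q where PQ: "P \<in> carrier ?T" "Q \<in> carrier ?T"
    and expand: "\<And>c. c \<noteq> 0 \<Longrightarrow> border_approx c = (\<lambda>A. border_tensor A + (c * P A + c * c * Q A))"
    using border_approx_expansion by blast
  \<comment> \<open>A null sequence of nonzero scalars, so that the expansion holds at every
    index.\<close>
  define c :: "nat \<Rightarrow> 'k" where "c m = of_real (inverse (real (Suc m)))" for m
  have c: "c m \<noteq> 0" for m
    unfolding c_def of_real_eq_0_iff by simp
  have "c \<longlonglongrightarrow> of_real 0"
    unfolding c_def by (intro tendsto_of_real LIMSEQ_inverse_real_of_nat)
  then have "limitin mtopology (\<lambda>m. border_approx (c m)) border_tensor sequentially"
    using T.limitin_norm_quadratic[OF border_tensor_closed PQ, of c]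
    by (simp add: expand[OF c] del: One_nat_def)
  moreover have "\<forall>\<^sub>F m in sequentially. border_approx (c m) \<in> rank_le r ?I X"
    by (intro always_eventually allI border_approx_rank)
  \<comment> \<open>A complete subset of a metric space is closed, so it contains the limit of the
    approximations.\<close>
  ultimately have "border_tensor \<in> rank_le r ?I X"
    by (rule limitin_closedin[OF _ mcomplete_imp_closedin[OF complete] _ trivial_limit_sequentially])
  then show False
    using border_tensor_rank by contradiction
qed

end
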